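(* Let $n$ and $k$ be relatively prime integers with $0<k<n$. Then for any integer $0\leq m<n$, the number of northeastern lattice paths from $(0,0)$ to $(k,n-k)$ enclosing an area congruent to $m$ modulo $n$ is independent of $m$, and equal to $\frac{1}{n}\binom{n}{k}$.
   Context: A northeastern lattice path from $(0,0)$ to $(a,b)$ (with $a,b$ nonnegative integers) is a sequence of $a+b$ unit steps, each equal to $(1,0)$ (east) or $(0,1)$ (north), starting at $(0,0)$ and ending at $(a,b)$; so exactly $a$ steps are east and $b$ steps are north. The area enclosed by such a path is the area of the region of the rectangle $[0,a]\times[0,b]$ lying below (and to the right of) the path, i.e. the sum over all east steps of the $y$-coordinate at which the step is taken. Equivalently, it is the number of pairs consisting of a north step and a later east step. *)

theory Defs
  imports Complex_Main "HOL-Number_Theory.Cong"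
begin

datatype step = East | North

fun move :: "step \<Rightarrow> nat \<times> nat \<Rightarrow> nat \<times> nat" where
  "move East (x, y) = (x + 1, y)"
| "move North (x, y) = (x, y + 1)"

text \<open>The point reached from the origin after the first \<open>i\<close> steps of \<open>p\<close>.\<close>

definition position :: "step list \<Rightarrow> nat \<Rightarrow> nat \<times> nat" where
  "position p i = fold move (take i p) (0, 0)"

definition lattice_paths :: "nat \<Rightarrow> nat \<Rightarrow> step list set" where
  "lattice_paths a b = {p. length p = a + b \<and> position p (length p) = (a, b)}"

text \<open>The area below and to the right of the path: an east step at height \<open>y\<close>
  contributes a column of width 1 and height \<open>y\<close>.\<close>

definition area :: "step list \<Rightarrow> nat" where
  "area p = (\<Sum>i | i < length p \<and> p ! i = East. snd (position p i))"

end

theory Submission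
  imports Defs
begin

text \<open>
  The proof moves the first step of a path to its end. For a path from the origin to
  \<open>(k, n - k)\<close>, an east step taken at height \<open>0\<close> is then taken at height \<open>n - k\<close>, so the area grows
  by \<open>n - k\<close>; a north step moved to the end stops lifting each of the \<open>k\<close> east steps, so the area
  drops by \<open>k\<close>. Modulo \<open>n\<close> these two changes agree: \<open>rotate1\<close> always lowers the area by \<open>k\<close>
  (\<open>area_rotate1_cong\<close>). As \<open>rotate1\<close> permutes the paths with given endpoint, it maps the paths of
  area \<open>m + k\<close> bijectively onto those of area \<open>m\<close> modulo \<open>n\<close>. Because \<open>k\<close> is a unit modulo \<open>n\<close>,
  iterating this links all residue classes, so the \<open>n choose k\<close> paths are spread evenly over
  the \<open>n\<close> classes.
\<close>

lemma position_eq_counts: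
  assumes "i \<le> length p"
  shows "position p i = (count_list (take i p) East, count_list (take i p) North)"
  using assms
proof (induction i)
  case 0
  then show ?case by (simp add: position_def)
next
  case (Suc i)
  then have "position p (Suc i) = move (p ! i) (position p i)"
    by (simp add: position_def take_Suc_conv_app_nth)
  with Suc show ?case
    by (cases "p ! i") (simp_all add: take_Suc_conv_app_nth)
qed

lemma length_eq_counts: "length p = count_list p East + count_list p North"
proof (induction p)
  case (Cons s p)
  then show ?case by (cases s) simp_all
qed simp

lemma lattice_paths_eq_counts:
  "lattice_paths a b = {p. count_list p East = a \<and> count_list p North = b}"
  using length_eq_counts by (auto simp: lattice_paths_def position_eq_counts)

lemma card_lists_count_East:
  "finite {p. length p = n \<and> count_list p East = k} \<and>
   card {p. length p = n \<and> count_list p East = k} = n choose k"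
proof (induction n arbitrary: k)
  case 0
  have "{p :: step list. length p = 0 \<and> count_list p East = k} = (if k = 0 then {[]} else {})"
    by auto
  then show ?case by simp
next
  case (Suc n)
  let ?L = "\<lambda>n k. {p. length p = n \<and> count_list p East = k}"
  have split: "?L (Suc n) k =
      (#) North ` ?L n k \<union> (if k = 0 then {} else (#) East ` ?L n (k - 1))"
  proof (intro set_eqI iffI)
    fix p
    assume "p \<in> ?L (Suc n) k"
    then obtain s q where "p = s # q" "length q = n" "count_list (s # q) East = k"
      by (cases p) auto
    then show "p \<in> (#) North ` ?L n k \<union> (if k = 0 then {} else (#) East ` ?L n (k - 1))"
      by (cases s) auto
  qed (auto split: if_splits)
  have "card ((#) North ` ?L n k \<union> (#) East ` ?L n j)
      = card (?L n k) + card (?L n j)" for j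
    using Suc.IH by (subst card_Un_disjoint) (auto simp: card_image)
  then show ?case
    unfolding split using Suc.IH by (cases k) (auto simp: card_image)
qed

lemma card_lattice_paths: "finite (lattice_paths a b)" "card (lattice_paths a b) = a + b choose a"
proof -
  have "lattice_paths a b = {p. length p = a + b \<and> count_list p East = a}"
    using length_eq_counts by (auto simp: lattice_paths_eq_counts)
  then show "finite (lattice_paths a b)" "card (lattice_paths a b) = a + b choose a"
    using card_lists_count_East[of "a + b" a] by simp_all
qed

lemma area_eq_sum:
  "area p = (\<Sum>i<length p. if p ! i = East then count_list (take i p) North else 0)"
proof -
  have "area p = (\<Sum>i | i < length p \<and> p ! i = East. count_list (take i p) North)"
    unfolding area_def by (rule sum.cong) (auto simp: position_eq_counts)
  also have "\<dots> = (\<Sum>i \<in> {..<length p} \<inter> {i. p ! i = East}. count_list (take i p) North)"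
    by (rule sum.cong) auto
  finally show ?thesis by (simp add: sum.inter_restrict)
qed

lemma area_append_single:
  "area (p @ [s]) = area p + (if s = East then count_list p North else 0)"
proof -
  have "(\<Sum>i<length p. if (p @ [s]) ! i = East then count_list (take i (p @ [s])) North else 0)
      = area p"
    unfolding area_eq_sum by (rule sum.cong) (auto simp: nth_append)
  then show ?thesis by (simp add: area_eq_sum[of "p @ [s]"])
qed

lemma area_Cons: "area (s # p) = area p + (if s = North then count_list p East else 0)"
proof (induction p rule: rev_induct)
  case Nil
  then show ?case by (cases s) (simp_all add: area_eq_sum)
next
  case (snoc t p)
  then show ?case
    using area_append_single[of "s # p" t] area_append_single[of p t] by (cases s) auto
qed

text \<open>Moving a first step north removes one unit of area for each east step. Moving a first step
  east adds one unit for each north step, and modulo the length this is the same change, because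
  the numbers of east and north steps add up to the length.\<close>

lemma area_rotate1_cong:
  "[area (rotate1 p) + count_list p East = area p] (mod length p)"
proof (cases p)
  case (Cons s q)
  show ?thesis
  proof (cases s)
    case East
    then have "area (rotate1 p) + count_list p East = area p + length p"
      using Cons length_eq_counts[of p] by (simp add: area_append_single area_Cons)
    then show ?thesis by (simp add: cong_def)
  next
    case North
    then show ?thesis using Cons by (simp add: area_append_single area_Cons)
  qed
qed simp

lemma count_list_rotate1 [simp]: "count_list (rotate1 p) x = count_list p x"
  by (cases p) simp_all

definition paths_of_area_class :: "nat \<Rightarrow> nat \<Rightarrow> nat \<Rightarrow> step list set" where
  "paths_of_area_class a b m = {p \<in> lattice_paths a b. [area p = m] (mod (a + b))}"

lemma rotate1_image_paths_of_area_class: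
  "rotate1 ` paths_of_area_class a b (m + a) = paths_of_area_class a b m"
proof -
  have mem_iff: "rotate1 p \<in> paths_of_area_class a b m \<longleftrightarrow> p \<in> paths_of_area_class a b (m + a)" for p
  proof (cases "p \<in> lattice_paths a b")
    case True
    then have "[area (rotate1 p) + a = area p] (mod (a + b))"
      using area_rotate1_cong[of p] length_eq_counts[of p] by (simp add: lattice_paths_eq_counts)
    then have "[area (rotate1 p) = m] (mod (a + b)) \<longleftrightarrow> [area p = m + a] (mod (a + b))"
      by (metis cong_add_rcancel_nat cong_sym cong_trans)
    with True show ?thesis
      by (simp add: paths_of_area_class_def lattice_paths_eq_counts)
  qed (auto simp: paths_of_area_class_def lattice_paths_eq_counts)
  show ?thesis
  proof (intro set_eqI iffI)
    fix q
    assume "q \<in> paths_of_area_class a b m"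
    moreover obtain p where "q = rotate1 p"
      using bij_rotate1 by (metis bij_pointE)
    ultimately show "q \<in> rotate1 ` paths_of_area_class a b (m + a)"
      using mem_iff by blast
  qed (use mem_iff in blast)
qed

lemma card_paths_of_area_class_add_mult:
  "card (paths_of_area_class a b (m + j * a)) = card (paths_of_area_class a b m)"
proof (induction j)
  case (Suc j)
  have "card (paths_of_area_class a b (m + j * a + a)) = card (paths_of_area_class a b (m + j * a))"
    by (metis rotate1_image_paths_of_area_class card_image inj_on_subset subset_UNIV inj_rotate1)
  with Suc show ?case by (simp add: algebra_simps)
qed simp

text \<open>Every residue \<open>m\<close> is a multiple \<open>j * a\<close> of the unit \<open>a\<close>, so \<open>j\<close> rotations lead from the
  class of \<open>m\<close> to that of \<open>0\<close>.\<close>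

lemma card_paths_of_area_class_coprime:
  assumes "coprime a (a + b)"
  shows "card (paths_of_area_class a b m) = card (paths_of_area_class a b 0)"
proof -
  obtain j where "[a * j = m] (mod (a + b))"
    using assms cong_solve_coprime_nat[of a "a + b"] cong_scalar_right[of _ 1 "a + b" m]
    by (metis mult.assoc mult_1 One_nat_def)
  then have "[0 + j * a = m] (mod (a + b))"
    by (simp add: mult.commute)
  then have "paths_of_area_class a b m = paths_of_area_class a b (0 + j * a)"
    unfolding paths_of_area_class_def by (meson cong_sym cong_trans)
  then show ?thesis
    using card_paths_of_area_class_add_mult[of a b 0 j] by simp
qed

lemma sum_card_paths_of_area_class:
  assumes "0 < a + b"
  shows "(\<Sum>m<a + b. card (paths_of_area_class a b m)) = a + b choose a"
proof -
  have "(\<Union>m<a + b. paths_of_area_class a b m) = lattice_paths a b"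
    using assms unfolding paths_of_area_class_def
    by (auto intro!: bexI[of _ "area _ mod (a + b)"] simp: cong_def)
  moreover have "card (\<Union>m<a + b. paths_of_area_class a b m)
      = (\<Sum>m<a + b. card (paths_of_area_class a b m))"
  proof (rule card_UN_disjoint)
    show "\<forall>m\<in>{..<a + b}. finite (paths_of_area_class a b m)"
      by (simp add: paths_of_area_class_def card_lattice_paths(1))
  qed (auto simp: paths_of_area_class_def cong_def)
  ultimately show ?thesis by (simp add: card_lattice_paths(2))
qed

theorem theorem4:
  fixes n k m :: nat
  assumes "coprime n k" and "0 < k" and "k < n" and "m < n"
  shows "real (card {p \<in> lattice_paths k (n - k). [area p = m] (mod n)}) = 1 / real n * real (n choose k)"
proof -
  let ?C = "paths_of_area_class k (n - k)"
  have n: "k + (n - k) = n" using \<open>k < n\<close> by simp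
  have "card (?C i) = card (?C m)" for i
    using card_paths_of_area_class_coprime[of k "n - k"] \<open>coprime n k\<close> n
    by (metis coprime_commute)
  then have "(\<Sum>i<n. card (?C i)) = (\<Sum>i<n. card (?C m))"
    by (intro sum.cong) auto
  then have "n * card (?C m) = n choose k"
    using sum_card_paths_of_area_class[of k "n - k"] n \<open>k < n\<close> by simp
  then have "real n * real (card (?C m)) = real (n choose k)"
    by (metis of_nat_mult)
  then show ?thesis
    using n \<open>k < n\<close> by (simp add: paths_of_area_class_def field_simps)
qed

end
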